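(* Let $p$ be an odd prime. Then $$\sum_{k=0}^{p-1}(8k+1)\frac{(\frac{1}{4})_k^5(\frac{1}{2})_k}{(\frac{3}{4})_k\,k!^5}\equiv\begin{cases}\dfrac{p\,(\frac{1}{2})_{(p-1)/4}^2}{((p-1)/4)!^2} \pmod{p^3}, &\text{if }p\equiv 1\pmod{4},\\[10pt] 0 \pmod{p^3},&\text{if }p\equiv 3\pmod{4}.\end{cases}$$
   Context: $(x)_k=x(x+1)\cdots(x+k-1)$, with $(x)_0=1$, is the Pochhammer symbol; $(x)_k^s$ denotes the $s$-th power of $(x)_k$, and $k!^s$ the $s$-th power of $k!$. For rational numbers $A,B$, $A\equiv B\pmod{p^3}$ means that the numerator of $A-B$, in lowest terms, is divisible by $p^3$. *)

theory Defs
  imports Complex_Main "HOL-Number_Theory.Number_Theory"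
begin

(* quotient_of yields numerator and denominator in lowest terms, so nothing is assumed here
   about the individual arguments being integral at the primes dividing m. *)
definition rat_cong :: "rat \<Rightarrow> rat \<Rightarrow> nat \<Rightarrow> bool" where
  "rat_cong a b m \<longleftrightarrow> int m dvd fst (quotient_of (a - b))"

end

theory Submission
  imports Defs
begin

text \<open>
  The sum is a truncated very well-poised series with base parameter \<open>a = 1/4\<close> and further numerator
  parameters \<open>1/4, 1/4, 1/4, 1/4, 1/2\<close>. These satisfy \<open>1 + 2 * a = 4 * (1/4) + 1/2\<close>, which is the
  2-balance condition of Dougall's summation for terminating \<open>7F6\<close> series; the series itself just does not
  terminate. It does after a small \<open>p\<close>-adic perturbation.

  Let \<open>r = p mod 4\<close>, so that \<open>r * p = 4 * m + 1\<close> with \<open>m < p\<close>, and put \<open>u = r * p / 4 = m + 1/4\<close>.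
  Move the four parameters \<open>1/4\<close> to \<open>1/4 + w\<close> where \<open>w\<close> runs through the fourth roots
  \<open>u, -u, i * u, -i * u\<close> of \<open>u^4\<close>. The balance condition survives, because the four shifts add up to 0.
  One parameter becomes \<open>1/4 - u = -m\<close>, so the series terminates and Dougall's formula sums it. And the
  factors \<open>(1/4 + j)^4 / (1 + j)^4\<close> of the terms turn into
  \<open>((1/4 + j)^4 - u^4) / ((1 + j)^4 - u^4)\<close>, so they change only modulo \<open>p^4\<close>. The remaining factor
  \<open>(1/4)_k (1/2)_k / ((3/4)_k k!)\<close> has at most one \<open>p\<close> in its denominator, so the sum is unchanged
  modulo \<open>p^3\<close> (lemma \<open>sum_cong_dougall\<close>). The value that Dougall's formula gives is
  \<open>r * p * (\<Prod>j<m. ((1/2 + j)^2 + u^2) / ((1 + j)^2 + u^2))\<close>. Its denominators are units at \<open>p\<close>.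
  If \<open>r = 1\<close>, dropping \<open>u^2\<close> changes the product modulo \<open>p^2\<close> only, which gives the claimed value. If
  \<open>r = 3\<close>, the index \<open>j = (p - 1) / 2\<close> is below \<open>m\<close>, and there the numerator is
  \<open>(p/2)^2 + (3 * p/4)^2\<close>; with the factor \<open>p\<close> in front the value is divisible by \<open>p^3\<close>.

  The imaginary shifts enter only through \<open>(1/4 + j)^2 + u^2\<close>, so everything takes place over the
  rationals. The special case of Dougall's formula that is used has one free parameter \<open>v\<close> in place of
  \<open>u^2\<close>; with \<open>v\<close> held fixed it is proved by the Wilf-Zeilberger method, as a recurrence in the
  terminating index (lemmas \<open>wz_step\<close> and \<open>dougall_one_parameter\<close>).
\<close>

section \<open>A one-parameter case of Dougall's summation\<close>

text \<open>
  With \<open>x = - (w^2)\<close> this is the well-poised pair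
  \<open>(1/4 + w)_k (1/4 - w)_k / ((1 + w)_k (1 - w)_k)\<close>. Using \<open>x\<close> in place of \<open>w\<close> keeps imaginary \<open>w\<close> inside
  an ordered field.
\<close>
definition wp_quot :: "'a::field_char_0 \<Rightarrow> nat \<Rightarrow> 'a" where
  "wp_quot x k = (\<Prod>j<k. ((1/4 + of_nat j)^2 + x) / ((1 + of_nat j)^2 + x))"

definition wp_base :: "nat \<Rightarrow> 'a::field_char_0" where
  "wp_base k = pochhammer (1/4) k * pochhammer (1/2) k / (pochhammer (3/4) k * fact k)"

lemma wp_quot_0 [simp]: "wp_quot x 0 = 1" by (simp add: wp_quot_def)
lemma wp_quot_Suc: "wp_quot x (Suc k) = wp_quot x k * (((1/4 + of_nat k)^2 + x) / ((1 + of_nat k)^2 + x))"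
  by (simp add: wp_quot_def)
lemma wp_base_0 [simp]: "wp_base 0 = 1" by (simp add: wp_base_def)
lemma wp_base_Suc: "wp_base (Suc k) =
   wp_base k * ((1/4 + of_nat k) * (1/2 + of_nat k) / ((3/4 + of_nat k) * (1 + of_nat k)))"
  by (simp add: wp_base_def pochhammer_Suc ac_simps)

text \<open>
  Keeps the denominators of \<open>wp_quot (- ((n + 1/4)^2))\<close> away from 0: multiplied by 4, the number is
  odd.
\<close>
lemma three_quarters_shift_nonzero: "(of_nat j + 3/4 - of_nat n :: 'a::field_char_0) \<noteq> 0"
proof
  assume "(of_nat j + 3/4 - of_nat n :: 'a) = 0"
  then have "4 * of_nat j + 3 = (4 * of_nat n :: 'a)" by (simp add: field_simps)
  then have "of_nat (4*j+3) = (of_nat (4*n) :: 'a)" by simp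
  then have "4*j+3 = 4*n" by (simp only: of_nat_eq_iff)
  then show False by presburger
qed

lemma wp_quot_terminating_Suc:
  fixes n k :: nat
  defines "N \<equiv> (of_nat n :: 'a::linordered_field)" and "K \<equiv> (of_nat k :: 'a)"
  shows "wp_quot (- ((N + 1/4)^2)) (Suc k) = wp_quot (- ((N + 1/4)^2)) k *
     ((K - N) * (N + 1/2 + K) / ((K + 5/4 + N) * (K + 3/4 - N)))"
proof -
  have "((1/4 + K)^2 + - ((N + 1/4)^2)) = (K - N) * (N + 1/2 + K)"
     "((1 + K)^2 + - ((N + 1/4)^2)) = (K + 5/4 + N) * (K + 3/4 - N)"
    by (simp_all add: power2_eq_square field_simps)
  then show ?thesis by (simp add: wp_quot_Suc K_def)
qed

text \<open>
  In the pair \<open>(-n)_k (n + 1/2)_k / ((n + 5/4)_k (3/4 - n)_k)\<close>, replacing \<open>n\<close> by \<open>n + 1\<close> moves every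
  Pochhammer symbol by one step. Comparing length \<open>k + 1\<close> with length \<open>k\<close> uses
  \<open>(-n-1)_(k+1) = (-n-1) (-n)_k\<close> and so avoids the division by \<open>n + 1 - k\<close>, which would fail at
  \<open>k = n + 1\<close>.
\<close>
lemma wp_quot_terminating_shift:
  fixes n k :: nat
  defines "N \<equiv> (of_nat n :: 'a::linordered_field)" and "K \<equiv> (of_nat k :: 'a)"
  shows "wp_quot (- ((N + 5/4)^2)) (Suc k) = wp_quot (- ((N + 1/4)^2)) k *
     ((N + 1) * (N + 1/2 + K) * (N + 3/2 + K) * (N + 5/4) /
       ((N + 1/2) * (N + 5/4 + K) * (N + 9/4 + K) * (N + 1/4)))"
  unfolding K_def
proof (induction k)
  case 0
  have "N \<ge> 0" by (simp add: N_def)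
  then have nz: "N + 1/2 \<noteq> 0" "N + 5/4 \<noteq> 0" "N + 9/4 \<noteq> 0" "N + 1/4 \<noteq> 0" by linarith+
  have "((1/4)^2 - (N + 5/4)^2) = - ((N+1) * (N + 3/2))" "(1 - (N + 5/4)^2) = - ((N+1/4) * (N + 9/4))"
    by (simp_all add: power2_eq_square algebra_simps)
  then show ?case using nz by (simp add: wp_quot_Suc)
next
  case (Suc k)
  define K where "K = (of_nat k :: 'a)"
  have "N \<ge> 0" "K \<ge> 0" by (simp_all add: N_def K_def)
  then have nz: "N + 1/2 \<noteq> 0" "N + 5/4 \<noteq> 0" "N + 9/4 \<noteq> 0" "N + 1/4 \<noteq> 0"
    "N + 5/4 + K \<noteq> 0" "N + 9/4 + K \<noteq> 0" "N + 13/4 + K \<noteq> 0" "K + 5/4 + N \<noteq> 0" by linarith+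
  have nz2: "K + 3/4 - N \<noteq> 0" unfolding K_def N_def by (rule three_quarters_shift_nonzero)
  have a: "of_nat (Suc n) = N + 1" "of_nat (Suc k) = K + 1" by (simp_all add: N_def K_def)
  have q: "N + 1 + 1/4 = N + 5/4" "K + 1 - (N + 1) = K - N" "N + 1 + 1/2 + (K + 1) = N + 5/2 + K"
    "K + 1 + 5/4 + (N + 1) = N + 13/4 + K" "K + 1 + 3/4 - (N + 1) = K + 3/4 - N"
    "N + 1/2 + (K + 1) = N + 3/2 + K" "N + 3/2 + (K + 1) = N + 5/2 + K"
    "N + 5/4 + (K + 1) = N + 9/4 + K" "N + 9/4 + (K + 1) = N + 13/4 + K" by simp_all
  have "wp_quot (- ((N + 5/4)^2)) (Suc (Suc k)) = wp_quot (- ((N + 5/4)^2)) (Suc k) *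
     ((K - N) * (N + 5/2 + K) / ((N + 13/4 + K) * (K + 3/4 - N)))"
    using wp_quot_terminating_Suc[where n = "Suc n" and k = "Suc k" and ?'a = 'a]
    unfolding a q .
  also have "\<dots> = wp_quot (- ((N + 1/4)^2)) k *
     ((N + 1) * (N + 1/2 + K) * (N + 3/2 + K) * (N + 5/4) /
       ((N + 1/2) * (N + 5/4 + K) * (N + 9/4 + K) * (N + 1/4))) * 
     ((K - N) * (N + 5/2 + K) / ((N + 13/4 + K) * (K + 3/4 - N)))"
    unfolding Suc K_def ..
  also have "\<dots> = wp_quot (- ((N + 1/4)^2)) k * ((K - N) * (N + 1/2 + K) / ((K + 5/4 + N) * (K + 3/4 - N))) *
     ((N + 1) * (N + 3/2 + K) * (N + 5/2 + K) * (N + 5/4) /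
       ((N + 1/2) * (N + 9/4 + K) * (N + 13/4 + K) * (N + 1/4)))"
    using nz by (simp add: ac_simps)
  also have "wp_quot (- ((N + 1/4)^2)) k * ((K - N) * (N + 1/2 + K) / ((K + 5/4 + N) * (K + 3/4 - N)))
     = wp_quot (- ((N + 1/4)^2)) (Suc k)"
    using wp_quot_terminating_Suc[where n = "n" and k = "k" and ?'a = 'a] by (simp add: N_def K_def)
  finally show ?case unfolding a q .
qed

text \<open>
  The term of the \<open>7F6\<close> series with base \<open>1/4\<close> and parameters \<open>1/2\<close>, \<open>1/4 \<plusminus> sqrt (- v)\<close>,
  \<open>- n\<close> and \<open>n + 1/2\<close>.
\<close>
definition dougall_term :: "'a::linordered_field \<Rightarrow> nat \<Rightarrow> nat \<Rightarrow> 'a" where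
  "dougall_term v n k = (8 * of_nat k + 1) * wp_base k * wp_quot v k * wp_quot (- ((of_nat n + 1/4)^2)) k"

text \<open>
  The rational-function identity behind the Wilf-Zeilberger proof. Here \<open>\<rho>\<close> is the quotient of
  the closed forms at \<open>n + 1\<close> and \<open>n\<close>; \<open>b\<close>, \<open>e\<close> and \<open>s\<close> are the quotients by which the factors of a
  term change from \<open>(n, k)\<close> to index \<open>k + 1\<close> (\<open>e\<close> for \<open>n\<close>, \<open>s\<close> for \<open>n + 1\<close>); and \<open>C * g\<close> is the
  certificate: the partial sum up to \<open>k\<close> of \<open>t (n + 1) i - \<rho> * t n i\<close> equals \<open>C * g K\<close> times the term
  at \<open>k\<close> without its factor \<open>8 * k + 1\<close>. In \<open>g\<close> stand the numerator factors of \<open>b\<close> and \<open>e\<close> except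
  \<open>K - N\<close>, over the single denominator factor \<open>K + 5/4 + N\<close> of \<open>e\<close>; the value of \<open>C\<close> is then forced
  by \<open>k = 0\<close>.
\<close>
lemma wz_step:
  fixes v N K :: "'a::linordered_field"
  assumes "N \<ge> 0" "K \<ge> 0" "v \<ge> 0" and nz: "K + 3/4 - N \<noteq> 0"
  defines "C \<equiv> - 16 * (4*N+5) / (((N+1)^2+v) * (4*N+1) * (2*N+1))"
    and "\<rho> \<equiv> (4*N+5) * ((1/2+N)^2+v) / ((4*N+1) * ((1+N)^2+v))"
    and "b \<equiv> (1/4 + K) * (1/2 + K) / ((3/4 + K) * (1 + K)) * (((1/4 + K)^2 + v) / ((1+K)^2+v))"
    and "e \<equiv> (K - N) * (N + 1/2 + K) / ((K + 5/4 + N) * (K + 3/4 - N))"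
    and "g \<equiv> (\<lambda>k. (k+1/4) * (k+1/2) * ((k+1/4)^2+v) * (N+1/2+k) / (k+5/4+N))"
    and "s \<equiv> (N + 1) * (N + 1/2 + K) * (N + 3/2 + K) * (N + 5/4) /
       ((N + 1/2) * (N + 5/4 + K) * (N + 9/4 + K) * (N + 1/4))"
  shows "C * g K + (8*(K+1)+1) * b * (s - \<rho> * e) = C * b * e * g (K+1)"
proof -
  define D1 where "D1 = (N+1)^2+v"
  define D2 where "D2 = (1+K)^2+v"
  define L where "L = K + 3/4 - N"
  define A where "A = 4*N+5"
  define X where "X = 2*(N+1)*(N+3/2+K)*D1*L - ((1/2+N)^2+v)*(K-N)*(2*N+1)*(N+9/4+K)"
  define Y where "Y = (K-N)*(K+5/4)*(K+3/2)*((K+5/4)^2+v)*(N+3/2+K)"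
  define Z where "Z = (3/4+K)*(1+K)*D2*L*(N+9/4+K)"
  define M where "M = (K+1/4)*(K+1/2)*((K+1/4)^2+v)*(N+1/2+K)/(K+5/4+N) * ((4*N+5)/((4*N+1)*(2*N+1)*D1))"
  have "D1 > 0" "D2 > 0" unfolding D1_def D2_def using assms by (auto intro!: add_pos_nonneg)
  then have nz': "4*N+1 \<noteq> 0" "2*N+1 \<noteq> 0" "3/4+K \<noteq> 0" "1+K \<noteq> 0" "K+5/4+N \<noteq> 0"
      "N+9/4+K \<noteq> 0" "L \<noteq> 0" "D1 \<noteq> 0" "D2 \<noteq> 0"
    using assms(1,2) nz unfolding L_def by (linarith | simp)+
  \<comment> \<open>After cancelling the common factor \<open>M\<close> and clearing denominators, only this is left.\<close>
  have polynomial_identity: "(8*K+9) * X = 16 * (Z - Y)"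
    unfolding X_def Y_def Z_def D1_def D2_def L_def by (simp add: field_simps power2_eq_square)
  have "Z \<noteq> 0" unfolding Z_def using nz' by simp
  have lhs1: "C * g K = M * (- 16)"
    unfolding C_def g_def M_def D1_def A_def[symmetric] by (simp add: ac_simps)
  have s': "s = (N+1/2+K)*(4*N+5)/((4*N+1)*(K+5/4+N)) * (2*(N+1)*(N+3/2+K)/((2*N+1)*(N+9/4+K)))"
  proof -
    have q: "N + 5/4 = (4*N+5)/4" "N + 1/2 = (2*N+1)/2" "N + 1/4 = (4*N+1)/4" "N+5/4+K = K+5/4+N"
      by (simp_all add: field_simps)
    show ?thesis unfolding s_def q using nz' by (simp add: divide_simps) (simp add: algebra_simps)
  qed
  have e': "\<rho> * e = (N+1/2+K)*(4*N+5)/((4*N+1)*(K+5/4+N)) * (((1/2+N)^2+v)*(K-N)/(D1*L))"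
    unfolding \<rho>_def e_def D1_def L_def add.commute[of 1 N] by (simp only: times_divide_times_eq ac_simps)
  have X': "2*(N+1)*(N+3/2+K)/((2*N+1)*(N+9/4+K)) - ((1/2+N)^2+v)*(K-N)/(D1*L)
      = X / (((2*N+1)*(N+9/4+K)) * (D1*L))"
    unfolding X_def using nz' by (subst diff_frac_eq) (simp_all add: ac_simps)
  have "s - \<rho> * e = (N+1/2+K)*(4*N+5)/((4*N+1)*(K+5/4+N)) * (X / (((2*N+1)*(N+9/4+K)) * (D1*L)))"
    unfolding s' e' X'[symmetric] by (simp only: right_diff_distrib)
  then have "(8*(K+1)+1) * b * (s - \<rho> * e) = M * ((8*K+9) * X / Z)"
    unfolding b_def M_def Z_def D2_def[symmetric] A_def[symmetric] by (simp add: ac_simps)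
  also have "\<dots> = M * (16 - 16 * Y / Z)"
    unfolding polynomial_identity using \<open>Z \<noteq> 0\<close> by (simp add: diff_divide_distrib right_diff_distrib)
  finally have "C * g K + (8*(K+1)+1) * b * (s - \<rho> * e) = M * (- 16 * Y / Z)"
    unfolding lhs1 by (simp add: algebra_simps)
  also have "\<dots> = C * b * e * g (K+1)"
  proof -
    have q: "K + 1 + 1/4 = K + 5/4" "K + 1 + 1/2 = K + 3/2" "N + 1/2 + (K+1) = N + 3/2 + K"
      "K + 1 + 5/4 + N = N + 9/4 + K" by simp_all
    show ?thesis
      unfolding C_def b_def e_def g_def q M_def Y_def Z_def D2_def[symmetric] D1_def[symmetric] L_def[symmetric] A_def[symmetric]
      by (simp add: ac_simps)
  qed
  finally show ?thesis .
qed

lemma wz_telescope: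
  fixes v :: "'a::linordered_field" and n k :: nat
  assumes "v \<ge> 0"
  defines "N \<equiv> (of_nat n :: 'a)" and "K \<equiv> (of_nat k :: 'a)"
  defines "C \<equiv> - 16 * (4*N+5) / (((N+1)^2+v) * (4*N+1) * (2*N+1))"
    and "\<rho> \<equiv> (4*N+5) * ((1/2+N)^2+v) / ((4*N+1) * ((1+N)^2+v))"
  shows "(\<Sum>i\<le>k. dougall_term v (Suc n) i - \<rho> * dougall_term v n i) =
    C * (wp_base k * wp_quot v k * wp_quot (- ((N + 1/4)^2)) k) * 
     ((K+1/4) * (K+1/2) * ((K+1/4)^2+v) * (N+1/2+K) / (K+5/4+N))"
  unfolding K_def
proof (induction k)
  case 0
  have N: "N \<ge> 0" by (simp add: N_def)
  define D1 where "D1 = (N+1)^2+v"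
  have "N + 1 > 0" using N by linarith
  then have "(N + 1)^2 > 0" by (rule zero_less_power)
  then have "D1 > 0" unfolding D1_def using assms(1) by (rule add_pos_nonneg)
  then have nz: "D1 \<noteq> 0" "4*N+1 \<noteq> 0" "2*N+1 \<noteq> 0" "N+5/4 \<noteq> 0" "5+4*N \<noteq> 0" using N by (linarith | simp)+
  have "1 - \<rho> = C * ((1/4) * (1/2) * ((1/4)^2+v) * (N+1/2) / (5/4+N))"
    unfolding C_def \<rho>_def D1_def[symmetric] add.commute[of 1 N] using nz
    by (simp add: divide_simps) (simp add: D1_def power2_eq_square algebra_simps)
  then show ?case by (simp add: dougall_term_def)
next
  case (Suc k)
  define K where "K = (of_nat k :: 'a)"
  have NK: "N \<ge> 0" "K \<ge> 0" by (simp_all add: N_def K_def)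
  have nz2: "K + 3/4 - N \<noteq> 0" unfolding K_def N_def by (rule three_quarters_shift_nonzero)
  let ?b = "(1/4 + K) * (1/2 + K) / ((3/4 + K) * (1 + K)) * (((1/4 + K)^2 + v) / ((1+K)^2+v))"
  let ?e = "(K - N) * (N + 1/2 + K) / ((K + 5/4 + N) * (K + 3/4 - N))"
  let ?g = "\<lambda>k. (k+1/4) * (k+1/2) * ((k+1/4)^2+v) * (N+1/2+k) / (k+5/4+N)"
  let ?s = "(N + 1) * (N + 1/2 + K) * (N + 3/2 + K) * (N + 5/4) /
       ((N + 1/2) * (N + 5/4 + K) * (N + 9/4 + K) * (N + 1/4))"
  let ?A = "wp_base k * wp_quot v k" let ?E = "wp_quot (- ((N + 1/4)^2)) k"
  have a: "of_nat (Suc n) = N + 1" "of_nat (Suc k) = K + 1" by (simp_all add: N_def K_def)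
  have A: "wp_base (Suc k) * wp_quot v (Suc k) = ?A * ?b"
    by (simp add: wp_base_Suc wp_quot_Suc K_def)
  have E: "wp_quot (- ((N + 1/4)^2)) (Suc k) = ?E * ?e"
    using wp_quot_terminating_Suc[where n = "n" and k = "k" and ?'a = 'a] by (simp add: N_def K_def)
  have E': "wp_quot (- ((N + 1 + 1/4)^2)) (Suc k) = ?E * ?s"
    using wp_quot_terminating_shift[where n = "n" and k = "k" and ?'a = 'a]
    by (simp add: N_def K_def add.assoc)
  have t: "dougall_term v (Suc n) (Suc k) = (8*(K+1)+1) * (?A * ?b) * (?E * ?s)"
    "dougall_term v n (Suc k) = (8*(K+1)+1) * (?A * ?b) * (?E * ?e)"
    unfolding dougall_term_def a A[symmetric] E'[symmetric] E[symmetric] N_def[symmetric]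
    by (simp_all add: mult.assoc)
  have step: "C * ?g K + (8*(K+1)+1) * ?b * (?s - \<rho> * ?e) = C * ?b * ?e * ?g (K+1)"
    unfolding C_def \<rho>_def by (rule wz_step[OF NK assms(1) nz2])
  have "(\<Sum>i\<le>Suc k. dougall_term v (Suc n) i - \<rho> * dougall_term v n i) =
     C * (?A * ?E) * ?g K + ((8*(K+1)+1) * (?A * ?b) * (?E * ?s) - \<rho> * ((8*(K+1)+1) * (?A * ?b) * (?E * ?e)))"
    unfolding sum.atMost_Suc Suc.IH t K_def ..
  also have "\<dots> = ?A * ?E * (C * ?g K + (8*(K+1)+1) * ?b * (?s - \<rho> * ?e))"
  proof -
    have "C * (A * E) * x + (q * (A * b) * (E * s) - \<rho> * (q * (A * b) * (E * e))) =
      A * E * (C * x + q * b * (s - \<rho> * e))" for A E b s e q x :: 'a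
      by (simp add: algebra_simps)
    then show ?thesis .
  qed
  also have "\<dots> = C * ((?A * ?b) * (?E * ?e)) * ?g (K+1)"
    unfolding step by (simp only: ac_simps)
  finally show ?case unfolding A E a .
qed

text \<open>
  At \<open>k = n + 1\<close> the certificate contains the factor \<open>(-n)_(n+1) = 0\<close>, so the telescoped sum vanishes and
  the full sums satisfy the same first-order recurrence in \<open>n\<close> as the closed form.
\<close>
lemma dougall_one_parameter:
  fixes v :: "'a::linordered_field"
  assumes "v \<ge> 0"
  shows "(\<Sum>k\<le>n. dougall_term v n k) =
    (4 * of_nat n + 1) * (\<Prod>j<n. ((1/2 + of_nat j)^2 + v) / ((1 + of_nat j)^2 + v))"
proof (induction n)
  case 0
  show ?case by (simp add: dougall_term_def)
next
  case (Suc n)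
  define N where "N = (of_nat n :: 'a)"
  let ?\<rho> = "(4*N+5) * ((1/2+N)^2+v) / ((4*N+1) * ((1+N)^2+v))"
  have N: "N \<ge> 0" by (simp add: N_def)
  have z: "wp_quot (- ((N + 1/4)^2)) (Suc n) = 0"
    by (simp add: wp_quot_terminating_Suc N_def)
  have "(\<Sum>i\<le>Suc n. dougall_term v (Suc n) i - ?\<rho> * dougall_term v n i) = 0"
    using wz_telescope[OF assms, of n "Suc n", folded N_def] unfolding z by simp
  then have "(\<Sum>i\<le>Suc n. dougall_term v (Suc n) i) = ?\<rho> * (\<Sum>i\<le>Suc n. dougall_term v n i)"
    by (simp only: sum_subtractf sum_distrib_left[symmetric] right_minus_eq)
  also have "(\<Sum>i\<le>Suc n. dougall_term v n i) = (\<Sum>i\<le>n. dougall_term v n i)"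
    using z by (simp add: dougall_term_def N_def)
  also note Suc.IH
  also have "?\<rho> * ((4 * of_nat n + 1) * (\<Prod>j<n. ((1/2 + of_nat j)^2 + v) / ((1 + of_nat j)^2 + v)))
     = (4 * N + 5) * ((\<Prod>j<n. ((1/2 + of_nat j)^2 + v) / ((1 + of_nat j)^2 + v)) * (((1/2+N)^2+v) / ((1+N)^2+v)))"
  proof -
    have "4 * N + 1 \<noteq> 0" using N by linarith
    then show ?thesis unfolding N_def[symmetric] by (simp add: ac_simps)
  qed
  finally show ?case by (simp add: N_def algebra_simps)
qed

section \<open>Rational numbers at a prime\<close>

text \<open>
  The ring of integers localised at \<open>p\<close>, its unit group, and congruence modulo \<open>p^e\<close> in it. The
  difference in a congruence must lie in \<open>p^e\<close> times that ring, while the two sides may have \<open>p\<close>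
  in their denominators: the terms of the sum do, if \<open>p mod 4 = 3\<close>.
\<close>
definition local_int :: "nat \<Rightarrow> rat \<Rightarrow> bool" where
  "local_int p x \<longleftrightarrow> (\<exists>a b. \<not> int p dvd b \<and> x = of_int a / of_int b)"

definition local_unit :: "nat \<Rightarrow> rat \<Rightarrow> bool" where
  "local_unit p x \<longleftrightarrow> (\<exists>a b. \<not> int p dvd a \<and> \<not> int p dvd b \<and> x = of_int a / of_int b)"

definition local_cong :: "nat \<Rightarrow> nat \<Rightarrow> rat \<Rightarrow> rat \<Rightarrow> bool" where
  "local_cong p e x y \<longleftrightarrow> (\<exists>z. local_int p z \<and> x - y = of_nat p ^ e * z)"

lemma local_unit_imp_int: "local_unit p x \<Longrightarrow> local_int p x"
  unfolding local_unit_def local_int_def by blast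

lemma local_unit_of_int: "prime p \<Longrightarrow> \<not> int p dvd a \<Longrightarrow> local_unit p (of_int a)"
  unfolding local_unit_def by (intro exI[of _ a] exI[of _ 1]) (auto dest: prime_gt_1_nat)

lemma local_unit_of_nat: "prime p \<Longrightarrow> \<not> p dvd a \<Longrightarrow> local_unit p (of_nat a)"
  using local_unit_of_int[of p "int a"] by simp

lemma local_unit_inverse: "local_unit p x \<Longrightarrow> local_unit p (1 / x)"
  unfolding local_unit_def by (metis of_int_1 divide_divide_eq_right mult_1)

lemma local_unit_nonzero: "local_unit p x \<Longrightarrow> x \<noteq> 0"
  unfolding local_unit_def by auto

lemma local_int_of_int [simp]: "prime p \<Longrightarrow> local_int p (of_int a)"
  unfolding local_int_def by (intro exI[of _ a] exI[of _ 1]) (auto dest: prime_gt_1_nat)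

lemma local_int_of_nat [simp]: "prime p \<Longrightarrow> local_int p (of_nat a)"
  using local_int_of_int[of p "int a"] by simp

lemma local_int_add: 
  assumes "prime p" "local_int p x" "local_int p y" shows "local_int p (x + y)"
proof -
  obtain a b c d where h: "\<not> int p dvd b" "x = of_int a / of_int b" "\<not> int p dvd d" "y = of_int c / of_int d"
    using assms unfolding local_int_def by blast
  have "b \<noteq> 0" "d \<noteq> 0" using h by auto
  then have "x + y = of_int (a * d + c * b) / of_int (b * d)" by (simp add: h add_frac_eq)
  moreover have "\<not> int p dvd b * d" using assms(1) h by (simp add: prime_dvd_mult_iff)
  ultimately show ?thesis unfolding local_int_def by blast
qed

lemma local_int_mult: 
  assumes "prime p" "local_int p x" "local_int p y" shows "local_int p (x * y)"
proof -
  obtain a b c d where h: "\<not> int p dvd b" "x = of_int a / of_int b" "\<not> int p dvd d" "y = of_int c / of_int d"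
    using assms unfolding local_int_def by blast
  then have "x * y = of_int (a * c) / of_int (b * d)" by simp
  moreover have "\<not> int p dvd b * d" using assms(1) h by (simp add: prime_dvd_mult_iff)
  ultimately show ?thesis unfolding local_int_def by blast
qed

lemma local_unit_mult: 
  assumes "prime p" "local_unit p x" "local_unit p y" shows "local_unit p (x * y)"
proof -
  obtain a b c d where h: "\<not> int p dvd a" "\<not> int p dvd b" "x = of_int a / of_int b"
     "\<not> int p dvd c" "\<not> int p dvd d" "y = of_int c / of_int d"
    using assms unfolding local_unit_def by blast
  then have "x * y = of_int (a * c) / of_int (b * d)" by simp
  moreover have "\<not> int p dvd b * d" "\<not> int p dvd a * c" using assms(1) h by (simp_all add: prime_dvd_mult_iff)
  ultimately show ?thesis unfolding local_unit_def by blast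
qed

lemma local_int_uminus: "prime p \<Longrightarrow> local_int p x \<Longrightarrow> local_int p (- x)"
  using local_int_of_int[of p "-1"] local_int_mult[of p "-1" x] by simp

lemma local_int_diff: "prime p \<Longrightarrow> local_int p x \<Longrightarrow> local_int p y \<Longrightarrow> local_int p (x - y)"
  using local_int_add[of p x "- y"] local_int_uminus by simp

lemma local_int_power: "prime p \<Longrightarrow> local_int p x \<Longrightarrow> local_int p (x ^ n)"
  using local_int_of_int[of p 1] by (induction n) (auto intro: local_int_mult)

lemma local_unit_power: "prime p \<Longrightarrow> local_unit p x \<Longrightarrow> local_unit p (x ^ n)"
  using local_unit_of_int[of p 1] by (induction n) (auto intro: local_unit_mult dest: prime_gt_1_nat)

lemma local_int_prod: "prime p \<Longrightarrow> (\<And>i. i \<in> A \<Longrightarrow> local_int p (f i)) \<Longrightarrow> local_int p (prod f A)"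
  using local_int_of_int[of p 1] by (induction A rule: infinite_finite_induct) (auto intro: local_int_mult)

lemma local_int_divide: "prime p \<Longrightarrow> local_int p x \<Longrightarrow> local_unit p d \<Longrightarrow> local_int p (x / d)"
  using local_int_mult[of p x "1 / d"] by (simp add: local_unit_inverse local_unit_imp_int)

lemma local_cong_refl [simp]: "prime p \<Longrightarrow> local_cong p e x x"
  unfolding local_cong_def using local_int_of_int[of p 0] by (intro exI[of _ 0]) simp

lemma local_cong_sym: "prime p \<Longrightarrow> local_cong p e x y \<Longrightarrow> local_cong p e y x"
  unfolding local_cong_def by (metis local_int_uminus minus_diff_eq mult_minus_right)

lemma local_cong_add:
  assumes "prime p" "local_cong p e x x'" "local_cong p e y y'"
  shows "local_cong p e (x + y) (x' + y')"
proof -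
  obtain z w where "local_int p z" "x - x' = of_nat p ^ e * z" "local_int p w" "y - y' = of_nat p ^ e * w"
    using assms unfolding local_cong_def by blast
  moreover from this have "x + y - (x' + y') = of_nat p ^ e * (z + w)" by (simp add: distrib_left)
  ultimately show ?thesis using local_int_add[OF assms(1)] unfolding local_cong_def by blast
qed

lemma local_cong_trans:
  assumes "prime p" "local_cong p e x y" "local_cong p e y z" shows "local_cong p e x z"
proof -
  obtain v w where "local_int p v" "x - y = of_nat p ^ e * v" "local_int p w" "y - z = of_nat p ^ e * w"
    using assms unfolding local_cong_def by blast
  moreover from this have "x - z = of_nat p ^ e * (v + w)" by (simp add: distrib_left)
  ultimately show ?thesis using local_int_add[OF assms(1)] unfolding local_cong_def by blast
qed

lemma local_cong_mult:
  assumes "prime p" "local_cong p e x x'" "local_cong p e y y'" "local_int p x" "local_int p y'"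
  shows "local_cong p e (x * y) (x' * y')"
proof -
  obtain z w where h: "local_int p z" "x - x' = of_nat p ^ e * z" "local_int p w" "y - y' = of_nat p ^ e * w"
    using assms unfolding local_cong_def by blast
  have "x * y - x' * y' = of_nat p ^ e * (x * w + z * y')"
  proof -
    have "x * y - x' * y' = x * (y - y') + (x - x') * y'" by (simp add: algebra_simps)
    then show ?thesis unfolding h
      by (simp add: algebra_simps)
  qed
  moreover have "local_int p (x * w + z * y')" using assms h by (intro local_int_add local_int_mult)
  ultimately show ?thesis unfolding local_cong_def by blast
qed

lemma local_cong_sum:
  "prime p \<Longrightarrow> (\<And>i. i \<in> A \<Longrightarrow> local_cong p e (f i) (g i)) \<Longrightarrow> local_cong p e (sum f A) (sum g A)"
  by (induction A rule: infinite_finite_induct) (auto intro: local_cong_add)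

lemma local_cong_prod:
  assumes "prime p" "\<And>i. i \<in> A \<Longrightarrow> local_int p (f i)" "\<And>i. i \<in> A \<Longrightarrow> local_int p (g i)"
    and "\<And>i. i \<in> A \<Longrightarrow> local_cong p e (f i) (g i)"
  shows "local_cong p e (prod f A) (prod g A)"
  using assms(2-)
proof (induction A rule: infinite_finite_induct)
  case (insert i A)
  then show ?case using assms(1) by (auto intro!: local_cong_mult local_int_prod)
qed (use assms(1) in auto)

lemma local_cong_divide:
  assumes "prime p" "local_cong p e x x'" "local_cong p e d d'" "local_int p x'" "local_unit p d" "local_unit p d'"
  shows "local_cong p e (x / d) (x' / d')"
proof -
  obtain z w where h: "local_int p z" "x - x' = of_nat p ^ e * z" "local_int p w" "d - d' = of_nat p ^ e * w"
    using assms unfolding local_cong_def by blast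
  have nz: "d \<noteq> 0" "d' \<noteq> 0" using assms local_unit_nonzero by blast+
  have "x / d - x' / d' = (x - x') / d - x' * (d - d') / (d * d')"
    using nz by (simp add: field_simps)
  also have "\<dots> = of_nat p ^ e * (z / d - x' * w / (d * d'))"
    unfolding h by (simp add: right_diff_distrib)
  finally have "x / d - x' / d' = of_nat p ^ e * (z / d - x' * w / (d * d'))" .
  moreover have "local_int p (z / d - x' * w / (d * d'))"
    using assms h by (intro local_int_diff local_int_divide local_int_mult local_unit_mult)
  ultimately show ?thesis unfolding local_cong_def by blast
qed

lemma local_unit_cong:
  assumes "prime p" "e > 0" "local_cong p e x y" "local_unit p x"
  shows "local_unit p y"
proof -
  obtain z where z: "local_int p z" "x - y = of_nat p ^ e * z" using assms unfolding local_cong_def by blast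
  obtain a b where ab: "\<not> int p dvd a" "\<not> int p dvd b" "x = of_int a / of_int b"
    using assms(4) unfolding local_unit_def by blast
  obtain c d where cd: "\<not> int p dvd d" "z = of_int c / of_int d" using z unfolding local_int_def by blast
  have "b \<noteq> 0" "d \<noteq> 0" using ab cd by auto
  then have "y = of_int (a * d - int p ^ e * c * b) / of_int (b * d)"
    using z(2) unfolding ab cd by (simp add: field_simps)
  moreover have "\<not> int p dvd b * d" using assms(1) ab cd by (simp add: prime_dvd_mult_iff)
  moreover have "\<not> int p dvd a * d - int p ^ e * c * b"
  proof
    assume "int p dvd a * d - int p ^ e * c * b"
    moreover have "int p dvd int p ^ e * c * b" using assms(2) by (simp add: dvd_power)
    ultimately have "int p dvd a * d - int p ^ e * c * b + int p ^ e * c * b" by (rule dvd_add)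
    then have "int p dvd a * d" by simp
    then show False using assms(1) ab cd by (simp add: prime_dvd_mult_iff)
  qed
  ultimately show ?thesis unfolding local_unit_def by blast
qed

text \<open>A factor with a simple pole at \<open>p\<close> costs one power of the modulus.\<close>
lemma local_cong_shift:
  assumes "prime p" "local_cong p (Suc e) x y" "local_int p (of_nat p * c)"
  shows "local_cong p e (c * x) (c * y)"
proof -
  obtain z where z: "local_int p z" "x - y = of_nat p ^ Suc e * z" using assms unfolding local_cong_def by blast
  have "c * x - c * y = of_nat p ^ e * (of_nat p * c * z)"
    unfolding right_diff_distrib[symmetric] z by simp
  then show ?thesis using local_int_mult[OF assms(1,3) z(1)] unfolding local_cong_def by blast
qed

lemma local_cong_mult_prime:
  "local_cong p e x y \<Longrightarrow> local_cong p (Suc e) (of_nat p * x) (of_nat p * y)"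
  unfolding local_cong_def right_diff_distrib[symmetric] by auto

lemma rat_cong_if_local_cong:
  assumes "prime p" "local_cong p e x y" shows "rat_cong x y (p ^ e)"
proof -
  obtain z where z: "local_int p z" "x - y = of_nat p ^ e * z" using assms unfolding local_cong_def by blast
  obtain a b where ab: "\<not> int p dvd b" "z = of_int a / of_int b" using z unfolding local_int_def by blast
  obtain n d where q: "quotient_of (x - y) = (n, d)" by fastforce
  have "d > 0" using quotient_of_denom_pos[OF q] .
  have "b \<noteq> 0" using ab by auto
  have "of_int n / of_int d = (of_nat p ^ e * (of_int a / of_int b) :: rat)"
    using quotient_of_div[OF q] z(2) ab(2) by simp
  then have "of_int (n * b) = (of_int (int p ^ e * a * d) :: rat)"
    using \<open>d > 0\<close> \<open>b \<noteq> 0\<close> by (simp add: field_simps)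
  then have "n * b = int p ^ e * a * d" by (simp only: of_int_eq_iff)
  then have "int p ^ e dvd n * b" by (simp add: mult.assoc)
  moreover have "coprime (int p ^ e) b" using assms(1) ab(1) by (simp add: prime_imp_coprime)
  ultimately have "int p ^ e dvd n" by (simp add: coprime_dvd_mult_left_iff)
  then show ?thesis unfolding rat_cong_def q by simp
qed

section \<open>Deforming the sum into a terminating one\<close>

lemma odd_prime_local_unit_power_of_two:
  assumes "prime p" "odd p"
  shows "local_unit p 2" "local_unit p 4"
proof -
  have "\<not> p dvd 2" using assms primes_dvd_imp_eq[of p 2] two_is_prime_nat by auto
  then show two: "local_unit p 2" using local_unit_of_nat[of p 2] assms by simp
  show "local_unit p 4" using local_unit_mult[OF assms(1) two two] by simp
qed

lemma local_int_fractions: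
  assumes "prime p" "odd p"
  shows "local_int p (1/4)" "local_int p (1/2)"
  using odd_prime_local_unit_power_of_two[OF assms] by (simp_all add: local_unit_inverse local_unit_imp_int)

lemma local_unit_Suc:
  assumes "prime p" "Suc j < p" shows "local_unit p (1 + of_nat j)"
proof -
  have "\<not> p dvd Suc j" using assms(2) by (auto dest: dvd_imp_le)
  then show ?thesis using local_unit_of_nat[OF assms(1), of "Suc j"] by simp
qed

lemma local_unit_fact:
  assumes "prime p" "k < p" shows "local_unit p (fact k)"
  using local_unit_of_nat[of p "fact k"] assms prime_dvd_fact_iff[of p k] by simp

text \<open>
  \<open>(x^2 + u^2) * (x^2 - u^2) = x^4 - u^4\<close>: deforming the two pairs in opposite directions cancels the
  contribution of order \<open>u^2\<close>.
\<close>
lemma wp_pair_cong: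
  assumes p: "prime p" "odd p" and "k < p" and t: "local_int p t" and u: "u = of_nat p * t"
  shows "local_cong p 4 (wp_quot 0 k ^ 2) (wp_quot (u^2) k * wp_quot (- (u^2)) k)"
proof -
  have l: "wp_quot 0 k ^ 2 = (\<Prod>j<k. (1/4 + of_nat j)^4 / (1 + of_nat j :: rat)^4)"
    unfolding wp_quot_def by (simp add: prod_power_distrib power_divide flip: power_mult)
  have "(a^2 + u^2) / (b^2 + u^2) * ((a^2 + - (u^2)) / (b^2 + - (u^2))) = (a^4 - u^4) / (b^4 - u^4)" for a b
    unfolding times_divide_times_eq by (simp add: algebra_simps flip: power_add)
  then have r: "wp_quot (u^2) k * wp_quot (- (u^2)) k =
      (\<Prod>j<k. ((1/4 + of_nat j)^4 - u^4) / ((1 + of_nat j)^4 - u^4))"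
    unfolding wp_quot_def prod.distrib[symmetric] by simp
  have u4: "local_cong p 4 x (x - u^4)" for x
    unfolding local_cong_def u power_mult_distrib using local_int_power[OF p(1) t] by auto
  have "local_int p u" unfolding u by (intro local_int_mult p t local_int_of_nat)
  show ?thesis unfolding l r
  proof (rule local_cong_prod[OF p(1)])
    fix j assume "j \<in> {..<k}"
    then have d: "local_unit p ((1 + of_nat j)^4)"
      using assms by (intro local_unit_power local_unit_Suc) auto
    have d': "local_unit p ((1 + of_nat j)^4 - u^4)"
      by (rule local_unit_cong[OF p(1) _ u4 d]) simp
    have n: "local_int p ((1/4 + of_nat j)^4)"
      using p by (intro local_int_power local_int_add local_int_fractions local_int_of_nat)
    have n': "local_int p ((1/4 + of_nat j)^4 - u^4)"
      by (intro local_int_diff n p local_int_power \<open>local_int p u\<close>)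
    show "local_int p ((1/4 + of_nat j)^4 / (1 + of_nat j)^4)"
      "local_int p (((1/4 + of_nat j)^4 - u^4) / ((1 + of_nat j)^4 - u^4))"
      using p n n' d d' by (auto intro: local_int_divide)
    show "local_cong p 4 ((1/4 + of_nat j)^4 / (1 + of_nat j)^4)
        (((1/4 + of_nat j)^4 - u^4) / ((1 + of_nat j)^4 - u^4))"
      by (rule local_cong_divide[OF p(1) u4 u4 n' d d'])
  qed
qed

text \<open>
  For \<open>j < p\<close> only one of the numbers \<open>4 * j + 3\<close> is divisible by \<open>p\<close>, namely \<open>s * p\<close> with
  \<open>s = 4 - p mod 4\<close>. Since \<open>s\<close> is 1 or 3 and \<open>p = 3\<close> has \<open>s = 1\<close>, it is divisible by \<open>p\<close> only once.
\<close>
lemma prime_over_pochhammer_three_quarters: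
  assumes p: "prime p" "odd p" and "k < p"
  shows "local_int p (of_nat p / pochhammer (3/4) k)"
proof -
  define s where "s = (4 - p mod 4)"
  have "p mod 4 = 1 \<or> p mod 4 = 3" using p(2) by presburger
  then have s13: "s = 1 \<or> s = 3" and "(s * p) mod 4 = 3"
    by (auto simp: s_def mod_mult_right_eq[symmetric, of _ p 4])
  then obtain i where i: "4 * i + 3 = s * p" by (metis mult_div_mod_eq)
  have "p \<ge> 3" using p prime_ge_2_nat[of p] by (cases "p = 2") auto
  then have "i < p" using i s13 by auto
  have s: "local_unit p (of_nat s)"
  proof (intro local_unit_of_nat p notI)
    assume "p dvd s"
    then have "p = s" using s13 \<open>p \<ge> 3\<close> by (auto dest: dvd_imp_le)
    then have "p mod 4 = 1" using s13 p(1) unfolding s_def by (auto simp: mod_eq_self_iff_div_eq_0)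
    then show False using \<open>p = s\<close> s13 p(1) by auto
  qed
  have four: "local_unit p 4" using odd_prime_local_unit_power_of_two[OF p] by simp
  have form: "3/4 + of_nat j = (of_nat (4 * j + 3) / 4 :: rat)" for j by simp
  have unit: "local_unit p (3/4 + of_nat j)" if "j < p" "j \<noteq> i" for j
  proof -
    have "\<not> p dvd 4 * j + 3"
    proof
      assume "p dvd 4 * j + 3"
      then have "[4 * j + 3 = 4 * i + 3] (mod p)" unfolding i by (simp add: cong_def)
      then have "[4 * j = 4 * i] (mod p)" by (simp add: cong_add_rcancel_nat)
      moreover have "coprime 4 p" using p(2) by (metis coprime_left_2_iff_odd coprime_mult_left_iff mult_2_right numeral_Bit0 mult_2 one_add_one)
      ultimately have "[j = i] (mod p)" by (simp add: cong_mult_lcancel_nat)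
      then show False using that \<open>i < p\<close> by (simp add: cong_def)
    qed
    then have "local_unit p (of_nat (4 * j + 3) * (1 / 4))"
      using p four by (intro local_unit_mult local_unit_of_nat local_unit_inverse)
    then show ?thesis unfolding form by simp
  qed
  have rest: "local_unit p (\<Prod>j\<in>A. 3/4 + of_nat j)" if "A \<subseteq> {..<p} - {i}" for A
  proof -
    have "finite A" using that finite_subset by blast
    then show ?thesis using that
      by (induction A rule: finite_induct)
        (use local_unit_of_nat[of p 1] p(1) unit in \<open>auto intro!: local_unit_mult dest: prime_gt_1_nat\<close>)
  qed
  have poch: "pochhammer (3/4 :: rat) k = (\<Prod>j<k. 3/4 + of_nat j)"
    by (simp add: pochhammer_prod atLeast0LessThan)
  show ?thesis
  proof (cases "i < k")
    case True
    have "pochhammer (3/4 :: rat) k = (3/4 + of_nat i) * (\<Prod>j\<in>{..<k} - {i}. 3/4 + of_nat j)"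
      unfolding poch using True by (subst prod.remove[of _ i]) auto
    also have "3/4 + of_nat i = (of_nat p * of_nat s / 4 :: rat)" unfolding form i by simp
    finally have split: "pochhammer (3/4 :: rat) k =
        of_nat p * of_nat s / 4 * (\<Prod>j\<in>{..<k} - {i}. 3/4 + of_nat j)" .
    have "of_nat p / pochhammer (3/4 :: rat) k =
        4 / (of_nat s * (\<Prod>j\<in>{..<k} - {i}. 3/4 + of_nat j))"
      unfolding split using prime_gt_0_nat[OF p(1)] by simp
    moreover have "local_unit p (\<Prod>j\<in>{..<k} - {i}. 3/4 + of_nat j)" using assms by (intro rest) auto
    ultimately show ?thesis using p s local_unit_imp_int[OF four] by (auto intro!: local_int_divide local_unit_mult)
  next
    case False
    then have "local_unit p (pochhammer (3/4) k)" unfolding poch using assms by (intro rest) auto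
    then show ?thesis using p by (intro local_int_divide local_int_of_nat)
  qed
qed

lemma prime_times_wp_base:
  assumes p: "prime p" "odd p" and "k < p"
  shows "local_int p (of_nat p * wp_base k)"
proof -
  have "local_int p (pochhammer x k)" if "local_int p x" for x
    unfolding pochhammer_prod using that p by (intro local_int_prod local_int_add local_int_of_nat)
  then have "local_int p (pochhammer (1/4) k * pochhammer (1/2) k * (of_nat p / pochhammer (3/4) k) / fact k)"
    using assms by (intro local_int_divide local_int_mult local_unit_fact prime_over_pochhammer_three_quarters)
      (auto intro: local_int_fractions)
  then show ?thesis by (simp add: wp_base_def ac_simps)
qed

lemma wp_quot_zero_eq: "wp_quot 0 k = (pochhammer (1/4) k / fact k) ^ 2"
  unfolding wp_quot_def pochhammer_fact pochhammer_prod atLeast0LessThan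
  by (simp add: prod_dividef power_divide prod_power_distrib)

text \<open>
  The deformed term is congruent to the original one for every \<open>k < p\<close>, also for \<open>m < k\<close>, where the
  deformed term is 0. So the sum up to \<open>p - 1\<close> is compared term by term with Dougall's sum up to \<open>m\<close>.
\<close>
lemma sum_cong_dougall:
  assumes p: "prime p" "odd p" and m: "4 * m + 1 = r * p" "m < p"
  defines "u \<equiv> of_nat (r * p) / 4"
  shows "local_cong p 3
    (\<Sum>k = 0..p - 1. (8 * of_nat k + 1) *
      (pochhammer (1 / 4) k ^ 5 * pochhammer (1 / 2) k) / (pochhammer (3 / 4) k * fact k ^ 5))
    (of_nat (r * p) * (\<Prod>j<m. ((1/2 + of_nat j)^2 + u^2) / ((1 + of_nat j)^2 + u^2)))"
    (is "local_cong p 3 (sum ?T _) ?R")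
proof -
  have um: "u = of_nat m + 1/4" unfolding u_def m(1)[symmetric] by simp
  have T: "?T k = (8 * of_nat k + 1) * wp_base k * wp_quot 0 k ^ 2" for k
    unfolding wp_quot_zero_eq wp_base_def
    by (simp add: power_divide eval_nat_numeral ac_simps)
  have "local_cong p 3 (?T k) (dougall_term (u^2) m k)" if "k < p" for k
  proof -
    have "local_cong p 4 (wp_quot 0 k ^ 2) (wp_quot (u^2) k * wp_quot (- (u^2)) k)"
      by (rule wp_pair_cong[OF p that, where t = "of_nat r / 4"])
        (use p odd_prime_local_unit_power_of_two[OF p] in
          \<open>auto simp: u_def intro!: local_int_divide local_int_of_nat\<close>)
    moreover have "local_int p (of_nat p * ((8 * of_nat k + 1) * wp_base k))"
      using local_int_mult[OF p(1) local_int_of_nat[OF p(1), of "8 * k + 1"] prime_times_wp_base[OF p that]]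
      by (simp add: ac_simps)
    ultimately have "local_cong p 3 ((8 * of_nat k + 1) * wp_base k * wp_quot 0 k ^ 2)
      ((8 * of_nat k + 1) * wp_base k * (wp_quot (u^2) k * wp_quot (- (u^2)) k))"
      by (intro local_cong_shift p) simp_all
    then show ?thesis unfolding T dougall_term_def um[symmetric] by (simp only: mult.assoc)
  qed
  then have "local_cong p 3 (\<Sum>k<p. ?T k) (\<Sum>k<p. dougall_term (u^2) m k)"
    by (intro local_cong_sum p) simp
  also have "(\<Sum>k<p. ?T k) = (\<Sum>k = 0..p - 1. ?T k)"
    using prime_gt_0_nat[OF p(1)] by (intro sum.cong) auto
  also have "(\<Sum>k<p. dougall_term (u^2) m k) = (\<Sum>k\<le>m. dougall_term (u^2) m k)"
  proof (rule sum.mono_neutral_right)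
    show "\<forall>k\<in>{..<p} - {..m}. dougall_term (u^2) m k = 0"
    proof
      fix k assume "k \<in> {..<p} - {..m}"
      then have "wp_quot (- ((of_nat m + 1/4)^2)) k = (0 :: rat)"
        unfolding wp_quot_def by (intro prod_zero) (auto intro!: bexI[of _ m] simp: add.commute)
      then show "dougall_term (u^2) m k = 0" by (simp add: dougall_term_def)
    qed
  qed (use m in auto)
  also have "\<dots> = ?R"
  proof -
    have "4 * of_nat m + 1 = (of_nat (r * p) :: rat)" unfolding m(1)[symmetric] by simp
    then show ?thesis using dougall_one_parameter[of "u^2" m] by simp
  qed
  finally show ?thesis .
qed

section \<open>The value of the terminating sum\<close>

lemma local_cong_add_square:
  assumes "prime p" "local_int p t"
  shows "local_cong p 2 x (x + (of_nat p * t)^2)"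
  unfolding local_cong_def power_mult_distrib
  using local_int_uminus[OF assms(1) local_int_power[OF assms]]
  by (intro exI[of _ "- (t^2)"]) simp

lemma dougall_numerator_int:
  assumes p: "prime p" "odd p" and t: "local_int p t"
  shows "local_int p ((1/2 + of_nat j)^2 + (of_nat p * t)^2)"
  by (intro local_int_add local_int_power local_int_mult local_int_fractions local_int_of_nat p t)

lemma dougall_denominator_unit:
  assumes p: "prime p" and "Suc j < p" and t: "local_int p t"
  shows "local_unit p ((1 + of_nat j)^2 + (of_nat p * t)^2)"
proof (rule local_unit_cong[OF p _ local_cong_add_square[OF p t]])
  show "local_unit p ((1 + of_nat j)^2)"
    using assms by (intro local_unit_power local_unit_Suc)
qed simp

lemma dougall_value_cong:
  assumes p: "prime p" "odd p" and "m < p" and t: "local_int p t" and u: "u = of_nat p * t"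
  shows "local_cong p 2 (\<Prod>j<m. ((1/2 + of_nat j)^2 + u^2) / ((1 + of_nat j)^2 + u^2))
    (pochhammer (1/2) m ^ 2 / fact m ^ 2)"
proof -
  have "local_cong p 2 (\<Prod>j<m. ((1/2 + of_nat j)^2 + u^2) / ((1 + of_nat j)^2 + u^2))
      (\<Prod>j<m. (1/2 + of_nat j)^2 / (1 + of_nat j)^2)"
    unfolding u
  proof (rule local_cong_prod[OF p(1)])
    fix j assume "j \<in> {..<m}"
    then have j: "Suc j < p" using \<open>m < p\<close> by simp
    note u2 = local_cong_sym[OF p(1) local_cong_add_square[OF p(1) t]]
    note d' = dougall_denominator_unit[OF p(1) j t] and n' = dougall_numerator_int[OF p t, of j]
    have d: "local_unit p ((1 + of_nat j)^2)" using p j by (intro local_unit_power local_unit_Suc)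
    have n: "local_int p ((1/2 + of_nat j)^2)"
      by (intro local_int_power local_int_add local_int_fractions local_int_of_nat p)
    show "local_int p (((1/2 + of_nat j)^2 + (of_nat p * t)^2) / ((1 + of_nat j)^2 + (of_nat p * t)^2))"
      by (rule local_int_divide[OF p(1) n' d'])
    show "local_int p ((1/2 + of_nat j)^2 / (1 + of_nat j)^2)"
      by (rule local_int_divide[OF p(1) n d])
    show "local_cong p 2 (((1/2 + of_nat j)^2 + (of_nat p * t)^2) / ((1 + of_nat j)^2 + (of_nat p * t)^2))
        ((1/2 + of_nat j)^2 / (1 + of_nat j)^2)"
      by (rule local_cong_divide[OF p(1) u2 u2 n d' d])
  qed
  also have "(\<Prod>j<m. (1/2 + of_nat j)^2 / (1 + of_nat j :: rat)^2) = pochhammer (1/2) m ^ 2 / fact m ^ 2"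
    unfolding pochhammer_fact pochhammer_prod atLeast0LessThan
    by (simp add: prod_dividef prod_power_distrib)
  finally show ?thesis .
qed

text \<open>
  The index \<open>h = (p - 1) / 2\<close> contributes \<open>1/2 + h = p/2\<close>, so both squares in its numerator are
  divisible by \<open>p^2\<close>.
\<close>
lemma dougall_value_cong_zero:
  assumes p: "prime p" "odd p" and "m < p" and "(p - 1) div 2 < m" and t: "local_int p t"
    and u: "u = of_nat p * t"
  shows "local_cong p 2 (\<Prod>j<m. ((1/2 + of_nat j)^2 + u^2) / ((1 + of_nat j)^2 + u^2)) 0"
proof -
  define h where "h = (p - 1) div 2"
  have h: "2 * h + 1 = p" using p(2) unfolding h_def by presburger
  have "h < m" using assms(4) by (simp add: h_def)
  let ?f = "\<lambda>j. ((1/2 + of_nat j)^2 + u^2) / ((1 + of_nat j)^2 + u^2)"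
  have half: "(1/2 + of_nat h :: rat) = of_nat p * (1/2)" unfolding h[symmetric] by (simp add: field_simps)
  have numerator: "(1/2 + of_nat h)^2 + u^2 = of_nat p ^ 2 * ((1/2)^2 + t^2)"
    unfolding half u power_mult_distrib by (simp only: distrib_left)
  have "(\<Prod>j<m. ?f j) = ?f h * (\<Prod>j\<in>{..<m} - {h}. ?f j)"
    using \<open>h < m\<close> by (subst prod.remove[of _ h]) auto
  also have "\<dots> = of_nat p ^ 2 *
      (((1/2)^2 + t^2) / ((1 + of_nat h)^2 + u^2) * (\<Prod>j\<in>{..<m} - {h}. ?f j))"
    unfolding numerator by simp
  finally have "(\<Prod>j<m. ?f j) - 0 = \<dots>" by simp
  moreover have "local_int p (((1/2)^2 + t^2) / ((1 + of_nat h)^2 + u^2) * (\<Prod>j\<in>{..<m} - {h}. ?f j))"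
    unfolding u using assms(3) \<open>h < m\<close>
    by (intro local_int_mult local_int_prod local_int_divide dougall_numerator_int local_int_add
        local_int_power local_int_fractions dougall_denominator_unit p t) auto
  ultimately show ?thesis unfolding local_cong_def by blast
qed

section \<open>The supercongruence\<close>

theorem corollary1p2:
  fixes p :: nat
  assumes "prime p" and "odd p"
  defines "S \<equiv> (\<Sum>k = 0..p - 1. (8 * of_nat k + 1) *
      (pochhammer (1 / 4 :: rat) k ^ 5 * pochhammer (1 / 2) k) / (pochhammer (3 / 4) k * fact k ^ 5))"
  shows "([p = 1] (mod 4) \<longrightarrow>
        rat_cong S (of_nat p * pochhammer (1 / 2) ((p - 1) div 4) ^ 2 / fact ((p - 1) div 4) ^ 2) (p ^ 3)) \<and>
      ([p = 3] (mod 4) \<longrightarrow> rat_cong S 0 (p ^ 3))"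
proof -
  note p = assms(1,2)
  have quarter: "local_int p (of_nat r / 4)" for r
    using p(1) odd_prime_local_unit_power_of_two[OF p] by (intro local_int_divide local_int_of_nat)
  have u: "of_nat (r * p) / 4 = of_nat p * (of_nat r / 4 :: rat)" for r by simp
  show ?thesis
  proof (intro conjI impI)
    assume "[p = 1] (mod 4)"
    define m where "m = (p - 1) div 4"
    have m: "4 * m + 1 = 1 * p" using \<open>[p = 1] (mod 4)\<close> prime_gt_0_nat[OF p(1)]
      unfolding m_def cong_def by presburger
    then have "m < p" by simp
    let ?P = "\<Prod>j<m. ((1/2 + of_nat j)^2 + (of_nat (1 * p) / 4)^2) / ((1 + of_nat j)^2 + (of_nat (1 * p) / 4)^2) :: rat"
    have "local_cong p (Suc 2) (of_nat p * ?P) (of_nat p * (pochhammer (1/2) m ^ 2 / fact m ^ 2))"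
      by (intro local_cong_mult_prime dougall_value_cong[OF p \<open>m < p\<close> quarter u])
    then have "local_cong p 3 (of_nat (1 * p) * ?P) (of_nat p * (pochhammer (1/2) m ^ 2 / fact m ^ 2))"
      by (simp only: mult_1 Suc_numeral add_num_simps)
    then have "local_cong p 3 S (of_nat p * (pochhammer (1/2) m ^ 2 / fact m ^ 2))"
      using local_cong_trans[OF p(1) sum_cong_dougall[OF p m \<open>m < p\<close>]] unfolding S_def by blast
    then show "rat_cong S (of_nat p * pochhammer (1/2) ((p - 1) div 4) ^ 2 / fact ((p - 1) div 4) ^ 2) (p ^ 3)"
      using rat_cong_if_local_cong[OF p(1)] unfolding m_def by simp
  next
    assume "[p = 3] (mod 4)"
    define m where "m = (3 * p - 1) div 4"
    have m: "4 * m + 1 = 3 * p" using \<open>[p = 3] (mod 4)\<close> unfolding m_def cong_def by presburger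
    then have "m < p" "(p - 1) div 2 < m" using p(2) by presburger+
    let ?P = "\<Prod>j<m. ((1/2 + of_nat j)^2 + (of_nat (3 * p) / 4)^2) / ((1 + of_nat j)^2 + (of_nat (3 * p) / 4)^2) :: rat"
    have zero: "local_int p 0" using local_int_of_nat[OF p(1), of 0] by simp
    have "local_cong p 2 ?P 0"
      by (rule dougall_value_cong_zero[OF p \<open>m < p\<close> \<open>(p - 1) div 2 < m\<close> quarter u])
    then have "local_cong p 2 (of_nat 3 * ?P) (of_nat 3 * 0)"
      by (rule local_cong_mult[OF p(1) local_cong_refl[OF p(1)] _ local_int_of_nat[OF p(1)] zero])
    then have "local_cong p (Suc 2) (of_nat p * (of_nat 3 * ?P)) (of_nat p * (of_nat 3 * 0))"
      by (rule local_cong_mult_prime)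
    then have "local_cong p 3 (of_nat (3 * p) * ?P) 0"
      by (simp only: of_nat_mult ac_simps mult_zero_left mult_zero_right Suc_numeral add_num_simps)
    then show "rat_cong S 0 (p ^ 3)"
      using rat_cong_if_local_cong[OF p(1)] local_cong_trans[OF p(1) sum_cong_dougall[OF p m \<open>m < p\<close>]]
      unfolding S_def by blast
  qed
qed

end
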